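(* There are constants $C_1>0$ and $C_2>0$, independent of $\lambda$ and $n$, such that for every $\lambda>0$ and every $n\ge 1$ $$\mathbb{E}\,\|\hat f_n-f_\lambda\|_k^2\le \frac{2C_1}{\lambda^2 n}+\frac{C_2}{\lambda^3 n}.$$
   Context: $\mathcal X$ is a topological space with its Borel $\sigma$-algebra (typically a subset of $\mathbb R^d$), and $k\colon\mathcal X\times\mathcal X\to\mathbb R$ is a symmetric, positive definite (all Gram matrices positive semidefinite), continuous, measurable and uniformly bounded kernel. $(\mathcal H_k,\|\cdot\|_k)$ is its reproducing kernel Hilbert space, with $\langle k(\cdot,x)\mid k(\cdot,y)\rangle_k=k(x,y)$. $(X,f)$ is a random pair in $\mathcal X\times\mathbb R$ with law $\rho$ and $f\in L^2$ (i.e. $\mathbb E f^2<\infty$). $P(\cdot)=\rho(\cdot\times\mathbb R)$ is the law of $X$, $L^2=L^2(\mathcal X,P)$, and $f_0(x)=\mathbb E(f\mid X=x)$. The operator $K$ is $Kw(x)=\int_{\mathcal X}k(x,y)\,w(y)\,P(dy)$ for $w\in L^2$. For $\lambda>0$, $w_\lambda\in L^2$ is the solution of $(\lambda+K)w_\lambda=f_0$, and $f_\lambda=Kw_\lambda\in\mathcal H_k$. $(X_i,f_i)$, $i=1,\dots,n$, are independent with law $\rho$. The estimator is $\hat f_n(\cdot)=\frac1n\sum_{i=1}^n k(\cdot,X_i)\,\hat w_i$, where the random weights solve $\lambda\hat w_i+\frac1n\sum_{j=1}^n k(X_i,X_j)\hat w_j=f_i$, $i=1,\dots,n$. *)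

theory Defs
  imports "HOL-Probability.Probability"
begin

text \<open>
  The input space is the carrier of a type of class \<^class>\<open>topological_space\<close>. That class
  does not include second countability, so joint continuity of the kernel does not give
  measurability with respect to the product of the Borel sigma-algebras; the latter is a
  separate assumption.
\<close>

locale bounded_kernel =
  fixes k :: "'x::topological_space \<Rightarrow> 'x \<Rightarrow> real"
  assumes symmetric: "k x y = k y x"
    and positive_definite:
      "\<And>(m :: nat) (c :: nat \<Rightarrow> real) (p :: nat \<Rightarrow> 'x).
         0 \<le> (\<Sum>i<m. \<Sum>j<m. c i * c j * k (p i) (p j))"
    and continuous: "continuous_on UNIV (\<lambda>(x, y). k x y)"
    and measurable: "(\<lambda>(x, y). k x y) \<in> borel_measurable (borel \<Otimes>\<^sub>M borel)"
    and bounded: "\<exists>B. \<forall>x y. \<bar>k x y\<bar> \<le> B"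

definition rkhs_norm :: "(('x \<Rightarrow> real) \<Rightarrow> ('x \<Rightarrow> real) \<Rightarrow> real) \<Rightarrow> ('x \<Rightarrow> real) \<Rightarrow> real" where
  "rkhs_norm ip f = sqrt (ip f f)"

text \<open>
  The carrier \<open>H\<close> with inner product \<open>ip\<close> is a real Hilbert space of functions that contains
  the sections of \<open>k\<close> and has the reproducing property. A given kernel has exactly one such
  pair, up to the values of \<open>ip\<close> outside \<open>H\<close>, which are unspecified. The reproducing property
  for \<open>f = k(\<cdot>, y)\<close> gives \<open>\<langle>k(\<cdot>, y) | k(\<cdot>, x)\<rangle> = k(x, y)\<close>.
\<close>

locale rkhs =
  fixes k :: "'x \<Rightarrow> 'x \<Rightarrow> real"
    and H :: "('x \<Rightarrow> real) set"
    and ip :: "('x \<Rightarrow> real) \<Rightarrow> ('x \<Rightarrow> real) \<Rightarrow> real"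
  assumes zero_mem: "(\<lambda>_. 0) \<in> H"
    and add_mem: "f \<in> H \<Longrightarrow> g \<in> H \<Longrightarrow> (\<lambda>t. f t + g t) \<in> H"
    and scale_mem: "f \<in> H \<Longrightarrow> (\<lambda>t. a * f t) \<in> H"
    and ip_commute: "f \<in> H \<Longrightarrow> g \<in> H \<Longrightarrow> ip f g = ip g f"
    and ip_add_left: "f \<in> H \<Longrightarrow> g \<in> H \<Longrightarrow> h \<in> H \<Longrightarrow> ip (\<lambda>t. f t + g t) h = ip f h + ip g h"
    and ip_scale_left: "f \<in> H \<Longrightarrow> g \<in> H \<Longrightarrow> ip (\<lambda>t. a * f t) g = a * ip f g"
    and ip_nonneg: "f \<in> H \<Longrightarrow> 0 \<le> ip f f"
    and ip_definite: "f \<in> H \<Longrightarrow> ip f f = 0 \<Longrightarrow> f = (\<lambda>_. 0)"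
    and complete:
      "(\<And>m. s m \<in> H) \<Longrightarrow>
       (\<And>e. e > 0 \<Longrightarrow> \<exists>N. \<forall>i\<ge>N. \<forall>j\<ge>N. rkhs_norm ip (\<lambda>t. s i t - s j t) < e) \<Longrightarrow>
       \<exists>l\<in>H. (\<lambda>m. rkhs_norm ip (\<lambda>t. s m t - l t)) \<longlonglongrightarrow> 0"
    and section_mem: "(\<lambda>t. k t x) \<in> H"
    and reproducing: "f \<in> H \<Longrightarrow> ip f (\<lambda>t. k t x) = f x"

definition input_law :: "('x::topological_space \<times> real) measure \<Rightarrow> 'x measure" where
  "input_law \<rho> = distr \<rho> borel fst"

text \<open>Elements of \<open>L\<^sup>2(P)\<close> are represented by functions, not by classes of functions.\<close>

definition sq_integrable :: "'x::topological_space measure \<Rightarrow> ('x \<Rightarrow> real) \<Rightarrow> bool" where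
  "sq_integrable P w \<longleftrightarrow> w \<in> borel_measurable P \<and> integrable P (\<lambda>x. (w x)\<^sup>2)"

definition kernel_op ::
    "('x::topological_space \<Rightarrow> 'x \<Rightarrow> real) \<Rightarrow> 'x measure \<Rightarrow> ('x \<Rightarrow> real) \<Rightarrow> 'x \<Rightarrow> real" where
  "kernel_op k P w x = (\<integral>y. k x y * w y \<partial>P)"

text \<open>
  \<open>f0\<close> is a version of \<open>x \<mapsto> E(f | X = x)\<close>: the coordinates \<open>fst\<close> and \<open>snd\<close> of the
  probability space \<open>\<rho>\<close> play the roles of \<open>X\<close> and \<open>f\<close>, and the sub-sigma-algebra is
  the one generated by \<open>fst\<close>.
\<close>

definition regression_function ::
    "('x::topological_space \<times> real) measure \<Rightarrow> ('x \<Rightarrow> real) \<Rightarrow> bool" where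
  "regression_function \<rho> f0 \<longleftrightarrow>
     f0 \<in> borel_measurable borel \<and>
     (AE z in \<rho>. real_cond_exp \<rho> (vimage_algebra (space \<rho>) fst borel) snd z = f0 (fst z))"

definition iid_sample ::
    "'w measure \<Rightarrow> ('x::topological_space \<times> real) measure \<Rightarrow> nat \<Rightarrow>
     (nat \<Rightarrow> 'w \<Rightarrow> 'x) \<Rightarrow> (nat \<Rightarrow> 'w \<Rightarrow> real) \<Rightarrow> bool" where
  "iid_sample M \<rho> n X F \<longleftrightarrow>
     prob_space M \<and>
     prob_space.indep_vars M (\<lambda>_. borel \<Otimes>\<^sub>M borel) (\<lambda>i \<omega>. (X i \<omega>, F i \<omega>)) {1..n} \<and>
     (\<forall>i\<in>{1..n}. distr M (borel \<Otimes>\<^sub>M borel) (\<lambda>\<omega>. (X i \<omega>, F i \<omega>)) = \<rho>)"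

definition solves_weights ::
    "('x \<Rightarrow> 'x \<Rightarrow> real) \<Rightarrow> real \<Rightarrow> nat \<Rightarrow> (nat \<Rightarrow> 'x) \<Rightarrow> (nat \<Rightarrow> real) \<Rightarrow> (nat \<Rightarrow> real) \<Rightarrow> bool" where
  "solves_weights k lam n x y w \<longleftrightarrow>
     (\<forall>i\<in>{1..n}. lam * w i + 1 / real n * (\<Sum>j=1..n. k (x i) (x j) * w j) = y i)"

definition estimator ::
    "('x \<Rightarrow> 'x \<Rightarrow> real) \<Rightarrow> nat \<Rightarrow> (nat \<Rightarrow> 'x) \<Rightarrow> (nat \<Rightarrow> real) \<Rightarrow> 'x \<Rightarrow> real" where
  "estimator k n x w t = 1 / real n * (\<Sum>i=1..n. k t (x i) * w i)"

end

theory Submission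
  imports Defs
begin

text \<open>
  Write \<open>g = Kw\<close> for the population solution and \<open>D\<close> for the difference of the estimator and \<open>g\<close>. Both
  functions solve a regularised equation in the reproducing kernel Hilbert space: with the
  covariance operator \<open>T h = E (h X * k(\<cdot>, X))\<close> and its empirical version \<open>T\<^sub>n\<close>, the estimator satisfies
  \<open>(lam + T\<^sub>n) f\<^sub>n = (\<Sum>i=1..n. F i * k(\<cdot>, X i)) / n\<close>. Subtracting \<open>(lam + T\<^sub>n) g\<close> gives
  \<open>(lam + T\<^sub>n) D = \<eta>\<close>, where \<open>\<eta>\<close> is the mean of the vectors
  \<open>\<zeta> (X i, F i) = (F i - g (X i)) * k(\<cdot>, X i) - lam * g\<close>. As \<open>T\<^sub>n\<close> is positive,
  \<open>\<parallel>D\<parallel> \<le> \<parallel>\<eta>\<parallel> / lam\<close> for every sample (\<open>estimator_deviation\<close>).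

  The vectors \<open>\<zeta> (X i, F i)\<close> are independent, and they are centred: conditioning on the input
  replaces \<open>F\<close> by \<open>f0\<close>, and \<open>f0 - g = lam * w\<close>, so that the mean of \<open>(F - g X) * k(\<cdot>, X)\<close> is
  \<open>lam * Kw = lam * g\<close> (\<open>fluctuation_degenerate\<close>). Hence \<open>E \<parallel>\<eta>\<parallel>\<^sup>2\<close> is the \<open>n\<close>-th part of the
  variance of a single \<open>\<zeta>\<close> (\<open>expectation_degenerate_double_sum\<close>). If \<open>B\<close> bounds the kernel, this
  variance is at most \<open>B * E (F - g X)\<^sup>2\<close>, and
  \<open>E F\<^sup>2 - E (F - g X)\<^sup>2 = 2 * lam * \<parallel>g\<parallel>\<^sup>2 + E (g X)\<^sup>2\<close> is nonnegative
  (\<open>integral_residual_sq_le\<close>). Altogether \<open>E \<parallel>D\<parallel>\<^sup>2 \<le> B * E F\<^sup>2 / (lam\<^sup>2 * n)\<close>.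

  No integrals with values in the Hilbert space occur: independence and centring are used through
  the real function \<open>\<langle>\<zeta> z | \<zeta> z'\<rangle>\<close>. Two facts are needed to give the norms a meaning. The function
  \<open>g\<close> is an element of the space, by the Riesz representation theorem (\<open>mean_embedding\<close>). The squared
  error is a random variable, because the weights are limits of an iteration that converges with a
  deterministic step size (\<open>weights_measurable\<close>).
\<close>

section \<open>Geometry of a reproducing kernel Hilbert space\<close>

context rkhs
begin

lemma diff_mem: "f \<in> H \<Longrightarrow> g \<in> H \<Longrightarrow> (\<lambda>t. f t - g t) \<in> H"
  using add_mem[of f "\<lambda>t. (-1) * g t"] scale_mem[of g "-1"] by simp

lemma ip_diff_left:
  assumes "f \<in> H" "g \<in> H" "h \<in> H"
  shows "ip (\<lambda>t. f t - g t) h = ip f h - ip g h"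
  using ip_add_left[of f "\<lambda>t. (-1) * g t" h] scale_mem[of g "-1"] ip_scale_left[of g h "-1"] assms
  by simp

lemma ip_add_right:
  assumes "f \<in> H" "g \<in> H" "h \<in> H"
  shows "ip h (\<lambda>t. f t + g t) = ip h f + ip h g"
  using ip_add_left[OF assms] ip_commute[OF assms(3) add_mem[OF assms(1,2)]]
    ip_commute[OF assms(3,1)] ip_commute[OF assms(3,2)] by simp

lemma ip_diff_right:
  assumes "f \<in> H" "g \<in> H" "h \<in> H"
  shows "ip h (\<lambda>t. f t - g t) = ip h f - ip h g"
  using ip_diff_left[OF assms] ip_commute[OF assms(3) diff_mem[OF assms(1,2)]]
    ip_commute[OF assms(3,1)] ip_commute[OF assms(3,2)] by simp

lemma ip_scale_right:
  assumes "f \<in> H" "g \<in> H"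
  shows "ip g (\<lambda>t. a * f t) = a * ip g f"
  using ip_scale_left[OF assms, of a] ip_commute[OF assms(2) scale_mem[OF assms(1)], of a]
    ip_commute[OF assms(2,1)] by simp

lemma ip_zero_left: "f \<in> H \<Longrightarrow> ip (\<lambda>_. 0) f = 0"
  using ip_scale_left[of f f 0] by simp

lemma lincomb_mem:
  "(\<And>i. i \<in> I \<Longrightarrow> h i \<in> H) \<Longrightarrow> (\<lambda>t. \<Sum>i\<in>I. c i * h i t) \<in> H"
proof (induction I rule: infinite_finite_induct)
  case (insert i I)
  then show ?case
    using add_mem[OF scale_mem[of "h i" "c i"], of "\<lambda>t. \<Sum>i\<in>I. c i * h i t"] by simp
qed (auto simp: zero_mem)

lemma ip_lincomb_left:
  "(\<And>i. i \<in> I \<Longrightarrow> h i \<in> H) \<Longrightarrow> f \<in> H \<Longrightarrow>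
   ip (\<lambda>t. \<Sum>i\<in>I. c i * h i t) f = (\<Sum>i\<in>I. c i * ip (h i) f)"
proof (induction I rule: infinite_finite_induct)
  case (insert i I)
  have "(\<lambda>t. \<Sum>i\<in>I. c i * h i t) \<in> H" "h i \<in> H"
    using insert.prems by (auto intro: lincomb_mem)
  then show ?case
    using insert by (simp add: ip_add_left ip_scale_left scale_mem)
qed (auto simp: ip_zero_left)

lemma ip_lincomb_right:
  "(\<And>i. i \<in> I \<Longrightarrow> h i \<in> H) \<Longrightarrow> f \<in> H \<Longrightarrow>
   ip f (\<lambda>t. \<Sum>i\<in>I. c i * h i t) = (\<Sum>i\<in>I. c i * ip f (h i))"
  using ip_commute[OF _ lincomb_mem, of f I h c] ip_lincomb_left[of I h f c]
  by (simp add: ip_commute)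

lemma norm_nonneg: "f \<in> H \<Longrightarrow> 0 \<le> rkhs_norm ip f"
  by (simp add: rkhs_norm_def ip_nonneg)

lemma norm_sq: "f \<in> H \<Longrightarrow> (rkhs_norm ip f)\<^sup>2 = ip f f"
  by (simp add: rkhs_norm_def ip_nonneg)

lemma Cauchy_Schwarz:
  assumes f: "f \<in> H" and g: "g \<in> H"
  shows "\<bar>ip f g\<bar> \<le> rkhs_norm ip f * rkhs_norm ip g"
proof (cases "ip g g = 0")
  case True
  then have "g = (\<lambda>_. 0)"
    using ip_definite g by blast
  then have "ip f g = 0"
    using ip_zero_left[OF f] ip_commute[OF f g] by simp
  then show ?thesis
    using norm_nonneg f g by simp
next
  case False
  then have pos: "ip g g > 0"
    using ip_nonneg[OF g] by simp
  define t where "t = ip f g / ip g g"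
  have tg: "(\<lambda>u. t * g u) \<in> H"
    by (rule scale_mem[OF g])
  have "0 \<le> ip (\<lambda>u. f u - t * g u) (\<lambda>u. f u - t * g u)"
    by (rule ip_nonneg[OF diff_mem[OF f tg]])
  also have "\<dots> = ip f f - 2 * t * ip f g + t * t * ip g g"
    using f g tg diff_mem[OF f tg]
    by (simp add: ip_diff_left ip_diff_right ip_scale_left ip_scale_right ip_commute[OF g f] algebra_simps)
  also have "\<dots> = ip f f - (ip f g)\<^sup>2 / ip g g"
    using pos by (simp add: t_def power2_eq_square field_simps)
  finally have "(ip f g)\<^sup>2 \<le> ip f f * ip g g"
    using pos by (simp add: field_simps)
  then have "sqrt ((ip f g)\<^sup>2) \<le> sqrt (ip f f * ip g g)"
    by (rule real_sqrt_le_mono)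
  then show ?thesis
    by (simp add: rkhs_norm_def real_sqrt_mult)
qed

lemma abs_eval_le:
  "f \<in> H \<Longrightarrow> \<bar>f x\<bar> \<le> rkhs_norm ip f * sqrt (k x x)"
  using Cauchy_Schwarz[OF _ section_mem, of f x] reproducing[of f x] reproducing[OF section_mem, of x x]
  by (simp add: rkhs_norm_def)

text \<open>
  The representing element is the minimiser of the functional
  \<open>J f = \<langle>f | f\<rangle> - 2 * L f\<close>, which is bounded below by \<open>- C\<^sup>2\<close>. The parallelogram law makes every
  minimising sequence Cauchy, and the first variation of \<open>J\<close> at its limit \<open>l\<close> is
  \<open>2 * (\<langle>l | h\<rangle> - L h)\<close>, which must vanish.
\<close>

lemma Riesz_representation:
  assumes add: "\<And>f g. f \<in> H \<Longrightarrow> g \<in> H \<Longrightarrow> L (\<lambda>t. f t + g t) = L f + L g"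
    and scale: "\<And>a f. f \<in> H \<Longrightarrow> L (\<lambda>t. a * f t) = a * L f"
    and bound: "\<And>f. f \<in> H \<Longrightarrow> \<bar>L f\<bar> \<le> C * rkhs_norm ip f"
  shows "\<exists>l\<in>H. \<forall>h\<in>H. ip h l = L h"
proof -
  define J where "J f = ip f f - 2 * L f" for f
  define m where "m = Inf (J ` H)"
  have lower: "- C\<^sup>2 \<le> J f" if "f \<in> H" for f
  proof -
    have "0 \<le> (rkhs_norm ip f - C)\<^sup>2" by simp
    then show ?thesis
      using bound[OF that] norm_sq[OF that] by (simp add: J_def power2_diff algebra_simps)
  qed
  then have bdd: "bdd_below (J ` H)"
    by (auto intro!: bdd_belowI[where m = "- C\<^sup>2"])
  have m_le: "m \<le> J f" if "f \<in> H" for f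
    unfolding m_def using bdd that by (simp add: cInf_lower)
  have "\<exists>f\<in>H. J f < m + 1 / real (Suc i)" for i
  proof -
    have "Inf (J ` H) < m + 1 / real (Suc i)"
      by (simp add: m_def)
    then show ?thesis
      using cInf_lessD[of "J ` H"] zero_mem by blast
  qed
  then obtain s where sH: "\<And>i. s i \<in> H" and sJ: "\<And>i. J (s i) < m + 1 / real (Suc i)"
    by metis
  have dist_sq: "ip (\<lambda>t. s i t - s j t) (\<lambda>t. s i t - s j t) \<le> 2 / real (Suc i) + 2 / real (Suc j)" for i j
  proof -
    let ?u = "\<lambda>t. (1/2) * (s i t + s j t)"
    have a: "(\<lambda>t. s i t + s j t) \<in> H" using sH add_mem by simp
    have "m \<le> J ?u"
      by (rule m_le[OF scale_mem[OF a]])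
    also have "J ?u = (ip (s i) (s i) + 2 * ip (s i) (s j) + ip (s j) (s j)) / 4 - L (s i) - L (s j)"
      unfolding J_def ip_scale_left[OF a scale_mem[OF a]] ip_scale_right[OF a a] scale[OF a] add[OF sH sH]
        ip_add_left[OF sH sH a] ip_add_right[OF sH sH sH] ip_commute[OF sH[of j] sH[of i]]
      by (simp add: algebra_simps)
    finally have "4 * m \<le> ip (s i) (s i) + 2 * ip (s i) (s j) + ip (s j) (s j) - 4 * L (s i) - 4 * L (s j)"
      by (simp add: field_simps)
    moreover have "ip (\<lambda>t. s i t - s j t) (\<lambda>t. s i t - s j t) = ip (s i) (s i) - 2 * ip (s i) (s j) + ip (s j) (s j)"
      unfolding ip_diff_left[OF sH sH diff_mem[OF sH sH]] ip_diff_right[OF sH sH sH] ip_commute[OF sH[of j] sH[of i]]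
      by simp
    ultimately show ?thesis
      using sJ[of i] sJ[of j] by (simp add: J_def)
  qed
  have "\<exists>N. \<forall>i\<ge>N. \<forall>j\<ge>N. rkhs_norm ip (\<lambda>t. s i t - s j t) < e" if "e > 0" for e
  proof -
    obtain N where N: "4 / e\<^sup>2 < real N"
      using reals_Archimedean2 by blast
    have "rkhs_norm ip (\<lambda>t. s i t - s j t) < e" if "i \<ge> N" "j \<ge> N" for i j
    proof -
      have "4 / e\<^sup>2 < real (Suc i)" "4 / e\<^sup>2 < real (Suc j)"
        using N that by auto
      then have "2 / real (Suc i) < e\<^sup>2 / 2" "2 / real (Suc j) < e\<^sup>2 / 2"
        using \<open>e > 0\<close> by (auto simp: field_simps)
      then have "ip (\<lambda>t. s i t - s j t) (\<lambda>t. s i t - s j t) < e\<^sup>2"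
        using dist_sq[of i j] by linarith
      then have "sqrt (ip (\<lambda>t. s i t - s j t) (\<lambda>t. s i t - s j t)) < sqrt (e\<^sup>2)"
        by (rule real_sqrt_less_mono)
      then show ?thesis
        using \<open>e > 0\<close> by (simp add: rkhs_norm_def)
    qed
    then show ?thesis by blast
  qed
  then obtain l where l: "l \<in> H" and lim: "(\<lambda>i. rkhs_norm ip (\<lambda>t. s i t - l t)) \<longlonglongrightarrow> 0"
    using complete[of s] sH by blast
  have "ip h l = L h" if h: "h \<in> H" for h
  proof -
    have "(\<lambda>i. ip (s i) h - ip l h) \<longlonglongrightarrow> 0"
    proof (rule Lim_null_comparison)
      show "\<forall>\<^sub>F i in sequentially. norm (ip (s i) h - ip l h) \<le> rkhs_norm ip (\<lambda>t. s i t - l t) * rkhs_norm ip h"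
        using Cauchy_Schwarz[OF diff_mem[OF sH l] h] by (simp add: ip_diff_left sH l h)
      show "(\<lambda>i. rkhs_norm ip (\<lambda>t. s i t - l t) * rkhs_norm ip h) \<longlonglongrightarrow> 0"
        using tendsto_mult_right[OF lim, of "rkhs_norm ip h"] by simp
    qed
    then have conv: "(\<lambda>i. ip (s i) h) \<longlonglongrightarrow> ip l h"
      using LIM_zero_iff by blast
    \<comment> \<open>\<open>J (s i + t h) \<ge> m\<close> and \<open>J (s i) < m + 1 / (i + 1)\<close>; in the limit the increment of \<open>J\<close>
      along \<open>t h\<close> is nonnegative.\<close>
    have var: "0 \<le> 2 * t * (ip l h - L h) + t\<^sup>2 * ip h h" for t
    proof (rule tendsto_lowerbound)
      show "(\<lambda>i. 2 * t * (ip (s i) h - L h) + t\<^sup>2 * ip h h + 1 / real (Suc i))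
              \<longlonglongrightarrow> 2 * t * (ip l h - L h) + t\<^sup>2 * ip h h"
        using tendsto_add[OF tendsto_add[OF tendsto_mult[OF tendsto_const[of "2*t"]
             tendsto_diff[OF conv tendsto_const[of "L h"]]] tendsto_const[of "t\<^sup>2 * ip h h"]] LIMSEQ_inverse_real_of_nat]
        by (simp add: inverse_eq_divide)
      have "0 \<le> 2 * t * (ip (s i) h - L h) + t\<^sup>2 * ip h h + 1 / real (Suc i)" for i
      proof -
        have th: "(\<lambda>u. t * h u) \<in> H" by (rule scale_mem[OF h])
        have "m \<le> J (\<lambda>u. s i u + t * h u)"
          by (rule m_le[OF add_mem[OF sH th]])
        also have "\<dots> = J (s i) + 2 * t * (ip (s i) h - L h) + t\<^sup>2 * ip h h"
          unfolding J_def ip_add_left[OF sH th add_mem[OF sH th]] ip_add_right[OF sH th sH]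
            ip_add_right[OF sH th th] add[OF sH th] scale[OF h] ip_scale_left[OF h sH]
            ip_scale_left[OF h th] ip_scale_right[OF h sH] ip_scale_right[OF h h] ip_commute[OF h sH]
          by (simp add: algebra_simps power2_eq_square)
        finally show ?thesis
          using sJ[of i] by simp
      qed
      then show "\<forall>\<^sub>F i in sequentially. 0 \<le> 2 * t * (ip (s i) h - L h) + t\<^sup>2 * ip h h + 1 / real (Suc i)"
        by simp
    qed simp
    define N where "N = ip h h"
    define \<delta> where "\<delta> = ip l h - L h"
    have N: "N \<ge> 0" using ip_nonneg[OF h] by (simp add: N_def)
    \<comment> \<open>The minimising \<open>t\<close> is \<open>- \<delta> / N\<close>; the denominator \<open>N + 1\<close> also covers \<open>N = 0\<close>.\<close>
    have "0 \<le> 2 * (- \<delta> / (N + 1)) * \<delta> + (- \<delta> / (N + 1))\<^sup>2 * N"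
      using var[of "- \<delta> / (N + 1)"] by (simp add: N_def \<delta>_def)
    also have "\<dots> = - (\<delta>\<^sup>2 * (N + 2)) / (N + 1)\<^sup>2"
    proof -
      define u where "u = N + 1"
      have "u \<noteq> 0" "N = u - 1" using N by (auto simp: u_def)
      then show ?thesis by (simp add: divide_simps power2_eq_square) (simp add: algebra_simps)
    qed
    finally have "\<delta>\<^sup>2 * (N + 2) / (N + 1)\<^sup>2 \<le> 0"
      by simp
    moreover have "0 < (N + 1)\<^sup>2"
      using N by simp
    ultimately have "\<delta>\<^sup>2 * (N + 2) \<le> 0"
      by (simp add: pos_divide_le_eq)
    then have "\<delta> = 0"
      using N by (simp add: mult_le_0_iff)
    then show ?thesis
      using ip_commute[OF h l] by (simp add: \<delta>_def)
  qed
  then show ?thesis using l by blast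
qed

end

section \<open>Measurable solution of positive linear systems\<close>

text \<open>
  Richardson's iteration \<open>c \<mapsto> c - \<tau> * ((lam + A) c - y)\<close> for the system \<open>(lam + A) c = y\<close>,
  started at zero. Every iterate is a polynomial in the data, hence a measurable function of
  them; its convergence is what makes the solution of a random system measurable.
\<close>

primrec richardson ::
    "real \<Rightarrow> real \<Rightarrow> 'i set \<Rightarrow> ('i \<Rightarrow> 'i \<Rightarrow> real) \<Rightarrow> ('i \<Rightarrow> real) \<Rightarrow> nat \<Rightarrow> 'i \<Rightarrow> real" where
  "richardson \<tau> lam I A y 0 = (\<lambda>_. 0)"
| "richardson \<tau> lam I A y (Suc m) = (\<lambda>i. richardson \<tau> lam I A y m i -
     \<tau> * (lam * richardson \<tau> lam I A y m i + (\<Sum>j\<in>I. A i j * richardson \<tau> lam I A y m j) - y i))"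

text \<open>
  With \<open>R = (lam + A) e\<close>, one step maps the error \<open>e\<close> to \<open>e - \<tau> * R\<close>. Positivity of \<open>A\<close> gives
  \<open>\<langle>e | R\<rangle> \<ge> lam * \<parallel>e\<parallel>\<^sup>2\<close>, the entrywise bound gives \<open>\<parallel>R\<parallel>\<^sup>2 \<le> Q * \<parallel>e\<parallel>\<^sup>2\<close> with
  \<open>Q = 2 * lam\<^sup>2 + 2 * (card I * b)\<^sup>2\<close>, and \<open>\<tau> = lam / Q\<close> minimises the resulting factor
  \<open>1 - 2 * \<tau> * lam + \<tau>\<^sup>2 * Q\<close>, to \<open>1 - lam\<^sup>2 / Q < 1\<close>. The step size depends only on the bound
  \<open>b\<close>, so it can be the same for all realisations of a random matrix.
\<close>

lemma richardson_tendsto: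
  fixes A :: "'i \<Rightarrow> 'i \<Rightarrow> real"
  assumes fin: "finite I" and lam: "lam > 0"
    and psd: "\<And>e :: 'i \<Rightarrow> real. 0 \<le> (\<Sum>i\<in>I. e i * (\<Sum>j\<in>I. A i j * e j))"
    and bnd: "\<And>i j. i \<in> I \<Longrightarrow> j \<in> I \<Longrightarrow> \<bar>A i j\<bar> \<le> b"
    and sol: "\<And>i. i \<in> I \<Longrightarrow> lam * w i + (\<Sum>j\<in>I. A i j * w j) = y i"
    and \<tau>: "\<tau> = lam / (2 * lam\<^sup>2 + 2 * (real (card I) * b)\<^sup>2)"
    and i: "i \<in> I"
  shows "(\<lambda>m. richardson \<tau> lam I A y m i) \<longlonglongrightarrow> w i"
proof -
  define Q where "Q = 2 * lam\<^sup>2 + 2 * (real (card I) * b)\<^sup>2"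
  have Q: "Q \<ge> 2 * lam\<^sup>2" "Q > 0"
    using lam by (auto simp: Q_def intro: add_pos_nonneg)
  define q where "q = 1 - lam\<^sup>2 / Q"
  have "lam\<^sup>2 / Q \<le> 1" "lam\<^sup>2 / Q > 0"
    using Q lam by (auto simp: divide_le_eq)
  then have q: "0 \<le> q" "q < 1"
    by (auto simp: q_def)
  define e where "e m i = richardson \<tau> lam I A y m i - w i" for m i
  define E where "E m = (\<Sum>i\<in>I. (e m i)\<^sup>2)" for m
  define R where "R m i = lam * e m i + (\<Sum>j\<in>I. A i j * e m j)" for m i
  have rec: "e (Suc m) i = e m i - \<tau> * R m i" if "i \<in> I" for m i
    using sol[OF that] by (simp add: e_def R_def algebra_simps sum_subtractf)
  have E0: "0 \<le> E m" for m
    by (simp add: E_def sum_nonneg)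
  have lower: "lam * E m \<le> (\<Sum>i\<in>I. e m i * R m i)" for m
  proof -
    have "(\<Sum>i\<in>I. e m i * R m i) = lam * E m + (\<Sum>i\<in>I. e m i * (\<Sum>j\<in>I. A i j * e m j))"
      by (simp add: R_def E_def distrib_left sum.distrib sum_distrib_left power2_eq_square mult.left_commute)
    then show ?thesis using psd[of "e m"] by simp
  qed
  have upper: "(\<Sum>i\<in>I. (R m i)\<^sup>2) \<le> Q * E m" for m
  proof -
    have "(\<Sum>j\<in>I. A i j * e m j)\<^sup>2 \<le> real (card I) * b\<^sup>2 * E m" if "i \<in> I" for i
    proof -
      have "(\<Sum>j\<in>I. (A i j)\<^sup>2) \<le> (\<Sum>j\<in>I. b\<^sup>2)"
        using bnd[OF that] by (intro sum_mono) (metis abs_ge_zero power2_abs power_mono)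
      then have "(\<Sum>j\<in>I. (A i j)\<^sup>2) * E m \<le> (real (card I) * b\<^sup>2) * E m"
        by (intro mult_right_mono E0) simp
      then show ?thesis
        using Cauchy_Schwarz_ineq_sum[of "A i" "e m" I] by (simp add: E_def)
    qed
    then have "(R m i)\<^sup>2 \<le> 2 * lam\<^sup>2 * (e m i)\<^sup>2 + 2 * (real (card I) * b\<^sup>2 * E m)" if "i \<in> I" for i
      using that sum_squares_bound[of "lam * e m i" "\<Sum>j\<in>I. A i j * e m j"]
      by (fastforce simp: R_def power2_sum power_mult_distrib)
    then have "(\<Sum>i\<in>I. (R m i)\<^sup>2) \<le> (\<Sum>i\<in>I. 2 * lam\<^sup>2 * (e m i)\<^sup>2 + 2 * (real (card I) * b\<^sup>2 * E m))"
      by (rule sum_mono)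
    also have "\<dots> = Q * E m"
      by (simp add: sum.distrib Q_def E_def sum_distrib_left[symmetric] power_mult_distrib algebra_simps power2_eq_square)
    finally show ?thesis .
  qed
  have tQ: "\<tau> = lam / Q" by (simp add: \<tau> Q_def)
  then have t0: "0 \<le> \<tau>" using lam Q by simp
  have step: "E (Suc m) \<le> q * E m" for m
  proof -
    have "E (Suc m) = (\<Sum>i\<in>I. (e m i - \<tau> * R m i)\<^sup>2)"
      unfolding E_def by (rule sum.cong) (auto simp: rec)
    also have "\<dots> = E m - 2 * \<tau> * (\<Sum>i\<in>I. e m i * R m i) + \<tau>\<^sup>2 * (\<Sum>i\<in>I. (R m i)\<^sup>2)"
      by (simp add: power2_diff sum.distrib sum_subtractf E_def sum_distrib_left power_mult_distrib algebra_simps)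
    also have "\<dots> \<le> E m - 2 * \<tau> * (lam * E m) + \<tau>\<^sup>2 * (Q * E m)"
      using mult_left_mono[OF lower[of m], of "2 * \<tau>"] mult_left_mono[OF upper[of m], of "\<tau>\<^sup>2"] t0 by simp
    also have "\<dots> = q * E m"
      using Q by (simp add: tQ q_def field_simps power2_eq_square)
    finally show ?thesis .
  qed
  have "E m \<le> q ^ m * E 0" for m
  proof (induction m)
    case (Suc m)
    then show ?case
      using step[of m] mult_left_mono[OF Suc q(1)] by (simp add: mult.assoc)
  qed simp
  moreover have "(e m i)\<^sup>2 \<le> E m" for m
    unfolding E_def using fin i by (intro member_le_sum) auto
  ultimately have sq: "(e m i)\<^sup>2 \<le> q ^ m * E 0" for m
    using order_trans by blast
  have "(\<lambda>m. (e m i)\<^sup>2) \<longlonglongrightarrow> 0"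
  proof (rule tendsto_sandwich[where f = "\<lambda>_. 0"])
    show "(\<lambda>m. q ^ m * E 0) \<longlonglongrightarrow> 0"
      using tendsto_mult_right[OF LIMSEQ_realpow_zero[OF q], of "E 0"] by simp
  qed (use sq in auto)
  then have "(\<lambda>m. sqrt ((e m i)\<^sup>2)) \<longlonglongrightarrow> sqrt 0"
    by (rule tendsto_real_sqrt)
  then have "(\<lambda>m. e m i) \<longlonglongrightarrow> 0"
    by (simp add: tendsto_rabs_zero_iff)
  then show ?thesis
    unfolding e_def using LIM_zero_iff by blast
qed

section \<open>Degenerate double sums over independent samples\<close>

lemma (in prob_space) indep_var_of_indep_vars:
  assumes "indep_vars S Z I" "i \<in> I" "j \<in> I" "i \<noteq> j"
  shows "indep_var (S i) (Z i) (S j) (Z j)"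
proof -
  have "indep_var (PiM {i} S) (\<lambda>\<omega>. restrict (\<lambda>l. Z l \<omega>) {i}) (PiM {j} S) (\<lambda>\<omega>. restrict (\<lambda>l. Z l \<omega>) {j})"
    using assms by (intro indep_var_restrict[OF assms(1)]) auto
  then have "indep_var (S i) ((\<lambda>f. f i) \<circ> (\<lambda>\<omega>. restrict (\<lambda>l. Z l \<omega>) {i}))
      (S j) ((\<lambda>f. f j) \<circ> (\<lambda>\<omega>. restrict (\<lambda>l. Z l \<omega>) {j}))"
    by (rule indep_var_compose) auto
  then show ?thesis by (simp add: o_def)
qed

text \<open>
  The vanishing of the integral of \<open>b z\<close> says that \<open>b\<close> is a degenerate kernel, for instance
  the inner products of a centred random vector. Then the pairs \<open>i \<noteq> j\<close>, which are distributed
  according to \<open>\<nu> \<Otimes>\<^sub>M \<nu>\<close>, contribute nothing by Fubini, and only the diagonal is left. This is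
  the additivity of the variance in a form that speaks of real functions only. The domination
  hypothesis transfers integrability from the diagonal to all pairs.
\<close>

lemma (in prob_space) expectation_degenerate_double_sum:
  fixes b :: "'z \<Rightarrow> 'z \<Rightarrow> real"
  assumes indep: "indep_vars (\<lambda>_. S) Z I"
    and law: "\<And>i. i \<in> I \<Longrightarrow> distr M S (Z i) = \<nu>"
    and fin: "finite I"
    and meas: "(\<lambda>p. b (fst p) (snd p)) \<in> borel_measurable (\<nu> \<Otimes>\<^sub>M \<nu>)"
    and diag: "integrable \<nu> (\<lambda>z. b z z)"
    and dom: "\<And>z z'. \<bar>b z z'\<bar> \<le> b z z + b z' z'"
    and degenerate: "\<And>z. (\<integral>z'. b z z' \<partial>\<nu>) = 0"
  shows "integrable M (\<lambda>\<omega>. \<Sum>i\<in>I. \<Sum>j\<in>I. b (Z i \<omega>) (Z j \<omega>))" (is ?int)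
    and "(\<integral>\<omega>. (\<Sum>i\<in>I. \<Sum>j\<in>I. b (Z i \<omega>) (Z j \<omega>)) \<partial>M) = real (card I) * (\<integral>z. b z z \<partial>\<nu>)" (is ?eq)
proof -
  have Z[measurable]: "Z i \<in> measurable M S" if "i \<in> I" for i
    using indep that by (auto simp: indep_vars_def)
  have diag_int: "integrable M (\<lambda>\<omega>. b (Z i \<omega>) (Z i \<omega>))"
    and diag_eq: "(\<integral>\<omega>. b (Z i \<omega>) (Z i \<omega>) \<partial>M) = (\<integral>z. b z z \<partial>\<nu>)" if i: "i \<in> I" for i
  proof -
    have sets: "sets \<nu> = sets S" using law[OF i] by auto
    have bm: "(\<lambda>z. b z z) \<in> borel_measurable S"
      using borel_measurable_integrable[OF diag] measurable_cong_sets[OF sets refl] by blast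
    show "integrable M (\<lambda>\<omega>. b (Z i \<omega>) (Z i \<omega>))"
      using integrable_distr_eq[OF Z[OF i] bm] diag law[OF i] by simp
    show "(\<integral>\<omega>. b (Z i \<omega>) (Z i \<omega>) \<partial>M) = (\<integral>z. b z z \<partial>\<nu>)"
      using integral_distr[OF Z[OF i] bm] law[OF i] by simp
  qed
  have off: "integrable M (\<lambda>\<omega>. b (Z i \<omega>) (Z j \<omega>)) \<and> (\<integral>\<omega>. b (Z i \<omega>) (Z j \<omega>) \<partial>M) = 0"
    if i: "i \<in> I" and j: "j \<in> I" and ne: "i \<noteq> j" for i j
  proof -
    have sets: "sets \<nu> = sets S" using law[OF i] by auto
    have pair: "\<nu> \<Otimes>\<^sub>M \<nu> = distr M (S \<Otimes>\<^sub>M S) (\<lambda>\<omega>. (Z i \<omega>, Z j \<omega>))"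
      using indep_var_of_indep_vars[OF indep i j ne] law[OF i] law[OF j]
      by (simp add: indep_var_distribution_eq)
    have Zij: "(\<lambda>\<omega>. (Z i \<omega>, Z j \<omega>)) \<in> measurable M (S \<Otimes>\<^sub>M S)"
      using Z[OF i] Z[OF j] by measurable
    have bm: "(\<lambda>p. b (fst p) (snd p)) \<in> borel_measurable (S \<Otimes>\<^sub>M S)"
      using meas measurable_cong_sets[OF sets_pair_measure_cong[OF sets sets] refl] by blast
    have int: "integrable M (\<lambda>\<omega>. b (Z i \<omega>) (Z j \<omega>))"
    proof (rule Bochner_Integration.integrable_bound)
      show "integrable M (\<lambda>\<omega>. b (Z i \<omega>) (Z i \<omega>) + b (Z j \<omega>) (Z j \<omega>))"
        using diag_int i j by simp
      show "(\<lambda>\<omega>. b (Z i \<omega>) (Z j \<omega>)) \<in> borel_measurable M"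
        using measurable_compose[OF Zij bm] by simp
      show "AE \<omega> in M. norm (b (Z i \<omega>) (Z j \<omega>)) \<le> norm (b (Z i \<omega>) (Z i \<omega>) + b (Z j \<omega>) (Z j \<omega>))"
        using dom by (auto intro!: AE_I2 order_trans[OF dom])
    qed
    interpret \<nu>: prob_space \<nu>
      using prob_space_distr[OF Z[OF i]] law[OF i] by simp
    interpret pair_sigma_finite \<nu> \<nu> ..
    have "integrable (\<nu> \<Otimes>\<^sub>M \<nu>) (\<lambda>p. b (fst p) (snd p))"
      unfolding pair using int by (simp add: integrable_distr_eq[OF Zij bm])
    from integral_fst'[OF this] have "(\<integral>p. b (fst p) (snd p) \<partial>(\<nu> \<Otimes>\<^sub>M \<nu>)) = 0"
      by (simp add: degenerate)
    then have "(\<integral>\<omega>. b (Z i \<omega>) (Z j \<omega>) \<partial>M) = 0"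
      unfolding pair by (simp add: integral_distr[OF Zij bm])
    with int show ?thesis by simp
  qed
  have int: "integrable M (\<lambda>\<omega>. b (Z i \<omega>) (Z j \<omega>))" if "i \<in> I" "j \<in> I" for i j
    using off diag_int that by (cases "i = j") auto
  then show ?int
    by (intro Bochner_Integration.integrable_sum) auto
  have "(\<integral>\<omega>. (\<Sum>i\<in>I. \<Sum>j\<in>I. b (Z i \<omega>) (Z j \<omega>)) \<partial>M) = (\<Sum>i\<in>I. \<Sum>j\<in>I. \<integral>\<omega>. b (Z i \<omega>) (Z j \<omega>) \<partial>M)"
    using int by (simp add: Bochner_Integration.integral_sum Bochner_Integration.integrable_sum)
  also have "\<dots> = (\<Sum>i\<in>I. \<Sum>j\<in>I. if j = i then \<integral>z. b z z \<partial>\<nu> else 0)"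
    using off diag_eq by (intro sum.cong refl) auto
  also have "\<dots> = real (card I) * (\<integral>z. b z z \<partial>\<nu>)"
    using fin by simp
  finally show ?eq .
qed

section \<open>The error of the estimator for a fixed sample\<close>

context rkhs
begin

lemma kernel_symmetric: "k x y = k y x"
  using reproducing[OF section_mem, of x y] reproducing[OF section_mem, of y x]
    ip_commute[OF section_mem section_mem, of x y] by simp

lemma gram_nonneg: "0 \<le> (\<Sum>i\<in>I. e i * (\<Sum>j\<in>I. k (x i) (x j) * e j))"
proof -
  let ?h = "\<lambda>t. \<Sum>i\<in>I. e i * k t (x i)"
  have h: "?h \<in> H" by (rule lincomb_mem) (rule section_mem)
  have "ip ?h ?h = (\<Sum>i\<in>I. e i * ip ?h (\<lambda>t. k t (x i)))"
    by (rule ip_lincomb_right) (use h section_mem in auto)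
  also have "\<dots> = (\<Sum>i\<in>I. e i * (\<Sum>j\<in>I. k (x i) (x j) * e j))"
    by (simp add: reproducing[OF h] mult.commute)
  finally show ?thesis using ip_nonneg[OF h] by simp
qed

lemma ip_diff_sections:
  "ip (\<lambda>t. k t x - k t y) (\<lambda>t. k t x - k t y) = k x x - 2 * k x y + k y y"
  by (simp add: reproducing ip_diff_right section_mem diff_mem kernel_symmetric[of y x])

lemma estimator_eq_lincomb: "estimator k n x w = (\<lambda>t. \<Sum>i=1..n. (w i / real n) * k t (x i))"
  by (simp add: estimator_def fun_eq_iff sum_distrib_left sum_divide_distrib mult.commute)

lemma estimator_mem: "estimator k n x w \<in> H"
  unfolding estimator_eq_lincomb by (intro lincomb_mem section_mem)

lemma ip_estimator:
  assumes "h \<in> H"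
  shows "ip h (estimator k n x w) = 1 / real n * (\<Sum>i=1..n. w i * h (x i))"
proof -
  have "ip h (estimator k n x w) = (\<Sum>i=1..n. (w i / real n) * ip h (\<lambda>t. k t (x i)))"
    unfolding estimator_eq_lincomb by (rule ip_lincomb_right) (auto simp: section_mem assms)
  then show ?thesis
    by (simp add: reproducing assms sum_divide_distrib)
qed

text \<open>
  The error \<open>D\<close> of the estimator solves a linear equation with right-hand side
  \<open>\<eta> = (\<Sum>i=1..n. \<zeta> i) / n\<close>. Indeed, the equation of the weights and the reproducing property give
  \<open>\<langle>D | \<eta>\<rangle> = lam * \<langle>D | D\<rangle> + (\<Sum>i=1..n. (D (x i))\<^sup>2) / n\<close>, that is, \<open>\<eta>\<close> is the image of \<open>D\<close> under \<open>lam\<close>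
  plus the positive empirical kernel operator. Dropping the sum and applying the
  Cauchy-Schwarz inequality gives \<open>lam * \<parallel>D\<parallel> \<le> \<parallel>\<eta>\<parallel>\<close>.
\<close>

lemma estimator_deviation:
  assumes w: "solves_weights k lam n x y w" and g: "g \<in> H" and lam: "lam > 0"
  defines "D \<equiv> (\<lambda>t. estimator k n x w t - g t)"
    and "\<zeta> \<equiv> (\<lambda>i t. (y i - g (x i)) * k t (x i) - lam * g t)"
  assumes n: "n \<ge> 1"
  shows "lam\<^sup>2 * ip D D \<le> 1 / (real n)\<^sup>2 * (\<Sum>i=1..n. \<Sum>j=1..n. ip (\<zeta> i) (\<zeta> j))"
proof -
  define \<eta> where "\<eta> = (\<lambda>t. \<Sum>i=1..n. 1 / real n * \<zeta> i t)"
  have D: "D \<in> H"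
    unfolding D_def by (intro diff_mem estimator_mem g)
  have \<zeta>: "\<zeta> i \<in> H" for i
    unfolding \<zeta>_def by (intro diff_mem scale_mem section_mem g)
  have \<eta>: "\<eta> \<in> H"
    unfolding \<eta>_def by (intro lincomb_mem \<zeta>)
  \<comment> \<open>\<open>y i - lam * w i\<close> is the value of the estimator at \<open>x i\<close>.\<close>
  have res: "y i - g (x i) = lam * w i + D (x i)" if "i \<in> {1..n}" for i
    using w that by (simp add: solves_weights_def D_def estimator_def)
  have ip_\<zeta>: "ip D (\<zeta> i) = (y i - g (x i)) * D (x i) - lam * ip D g" for i
    unfolding \<zeta>_def
    by (simp add: ip_diff_right scale_mem section_mem g D ip_scale_right reproducing)
  have "ip D \<eta> = (\<Sum>i=1..n. 1 / real n * ip D (\<zeta> i))"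
    unfolding \<eta>_def by (rule ip_lincomb_right) (auto simp: \<zeta> D)
  also have "\<dots> = (\<Sum>i=1..n. 1 / real n * (lam * (w i * D (x i)) + (D (x i))\<^sup>2 - lam * ip D g))"
    by (rule sum.cong) (auto simp: ip_\<zeta> res algebra_simps power2_eq_square)
  also have "\<dots> = lam * (1 / real n * (\<Sum>i=1..n. w i * D (x i))) - lam * ip D g + 1 / real n * (\<Sum>i=1..n. (D (x i))\<^sup>2)"
    using n by (simp add: sum.distrib sum_subtractf sum_distrib_left sum_divide_distrib[symmetric] add_divide_distrib diff_divide_distrib)
  also have "\<dots> = lam * ip D (estimator k n x w) - lam * ip D g + 1 / real n * (\<Sum>i=1..n. (D (x i))\<^sup>2)"
    by (simp add: ip_estimator[OF D])
  also have "lam * ip D (estimator k n x w) - lam * ip D g = lam * ip D D"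
    unfolding D_def[abs_def] using D estimator_mem g
    by (simp add: D_def ip_diff_right right_diff_distrib)
  finally have "lam * ip D D \<le> ip D \<eta>"
    by (simp add: sum_nonneg)
  also have "\<dots> \<le> rkhs_norm ip D * rkhs_norm ip \<eta>"
    using Cauchy_Schwarz[OF D \<eta>] by simp
  finally have *: "lam * (rkhs_norm ip D * rkhs_norm ip D) \<le> rkhs_norm ip D * rkhs_norm ip \<eta>"
    using norm_sq[OF D] by (simp add: power2_eq_square)
  have "lam * rkhs_norm ip D \<le> rkhs_norm ip \<eta>"
  proof (cases "rkhs_norm ip D = 0")
    case False
    then have "rkhs_norm ip D > 0" using norm_nonneg[OF D] by simp
    with * show ?thesis by (simp add: mult.left_commute[of lam])
  qed (use norm_nonneg[OF \<eta>] in simp)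
  then have "(lam * rkhs_norm ip D)\<^sup>2 \<le> (rkhs_norm ip \<eta>)\<^sup>2"
    using lam norm_nonneg[OF D] by (intro power_mono) auto
  then have "lam\<^sup>2 * ip D D \<le> ip \<eta> \<eta>"
    by (simp add: power_mult_distrib norm_sq D \<eta>)
  also have "ip \<eta> \<eta> = (\<Sum>i=1..n. 1 / real n * ip (\<zeta> i) \<eta>)"
    unfolding \<eta>_def by (rule ip_lincomb_left) (use \<eta> in \<open>auto simp: \<zeta> \<eta>_def\<close>)
  also have "\<dots> = (\<Sum>i=1..n. 1 / real n * (\<Sum>j=1..n. 1 / real n * ip (\<zeta> i) (\<zeta> j)))"
    unfolding \<eta>_def by (intro sum.cong refl arg_cong2[where f = "(*)"] ip_lincomb_right) (auto simp: \<zeta>)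
  also have "\<dots> = 1 / (real n)\<^sup>2 * (\<Sum>i=1..n. \<Sum>j=1..n. ip (\<zeta> i) (\<zeta> j))"
    by (simp add: sum_distrib_left sum_divide_distrib power2_eq_square)
  finally show ?thesis .
qed

end

section \<open>Embedding of the input law and conditional means\<close>

lemma integrable_bounded_mult:
  fixes h u :: "'z \<Rightarrow> real"
  assumes "h \<in> borel_measurable N" "\<And>x. \<bar>h x\<bar> \<le> c" "integrable N u"
  shows "integrable N (\<lambda>x. h x * u x)"
proof (rule Bochner_Integration.integrable_bound)
  show "integrable N (\<lambda>x. c * u x)"
    using assms by simp
  show "(\<lambda>x. h x * u x) \<in> borel_measurable N"
    using assms(1) borel_measurable_integrable[OF assms(3)] by simp
  show "AE x in N. norm (h x * u x) \<le> norm (c * u x)"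
    using order_trans[OF assms(2) abs_ge_self] by (intro AE_I2) (simp add: abs_mult mult_right_mono)
qed

locale kernel_regression = bounded_kernel k + rkhs k H ip + law: prob_space \<rho>
  for k :: "'x::topological_space \<Rightarrow> 'x \<Rightarrow> real" and H ip and \<rho> :: "('x \<times> real) measure" +
  fixes f0 :: "'x \<Rightarrow> real"
  assumes sets_law: "sets \<rho> = sets (borel \<Otimes>\<^sub>M borel)"
    and output_sq_integrable: "integrable \<rho> (\<lambda>z. (snd z)\<^sup>2)"
    and regression: "regression_function \<rho> f0"
begin

abbreviation "P \<equiv> input_law \<rho>"

lemma measurable_law: "measurable \<rho> N = measurable (borel \<Otimes>\<^sub>M borel) N"
  by (rule measurable_cong_sets) (auto simp: sets_law)

lemma fst_law [measurable]: "fst \<in> measurable \<rho> borel"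
  and snd_law [measurable]: "snd \<in> borel_measurable \<rho>"
  by (auto simp: measurable_law)

lemma sets_P: "sets P = sets borel"
  by (simp add: input_law_def)

lemma measurable_P: "measurable P N = measurable borel N"
  by (rule measurable_cong_sets) (auto simp: sets_P)

lemma prob_space_P: "prob_space P"
  unfolding input_law_def by (rule law.prob_space_distr) (rule fst_law)

lemma integral_P:
  fixes h :: "'x \<Rightarrow> real"
  assumes "h \<in> borel_measurable borel"
  shows "(\<integral>x. h x \<partial>P) = (\<integral>z. h (fst z) \<partial>\<rho>)"
  unfolding input_law_def by (rule integral_distr[OF fst_law assms])

lemma integrable_P:
  fixes h :: "'x \<Rightarrow> real"
  assumes "h \<in> borel_measurable borel"
  shows "integrable P h \<longleftrightarrow> integrable \<rho> (\<lambda>z. h (fst z))"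
  unfolding input_law_def by (rule integrable_distr_eq[OF fst_law assms])

text \<open>
  By Cauchy-Schwarz, \<open>\<bar>h y - h x\<bar>\<close> is at most the norm of \<open>h\<close> times the distance of the sections
  at \<open>y\<close> and \<open>x\<close>, which tends to zero by joint continuity of the kernel. In particular the
  elements of the space are Borel functions.
\<close>

lemma continuous_mem:
  assumes h: "h \<in> H"
  shows "continuous_on UNIV h"
unfolding continuous_on_def
proof (rule ballI)
  fix x
  have diag: "continuous_on UNIV (\<lambda>y. k y y)"
    using continuous_on_compose2[OF continuous, of UNIV "\<lambda>y. (y, y)"]
    by (simp add: continuous_on_Pair continuous_on_id)
  have sec: "continuous_on UNIV (\<lambda>y. k y x)"
    using continuous_on_compose2[OF continuous, of UNIV "\<lambda>y. (y, x)"]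
    by (simp add: continuous_on_Pair continuous_on_id)
  have lims: "((\<lambda>y. k y y) \<longlongrightarrow> k x x) (at x)" "((\<lambda>y. k y x) \<longlongrightarrow> k x x) (at x)"
    using diag sec by (auto simp: continuous_on_def)
  have "((\<lambda>y. rkhs_norm ip h * sqrt (k y y - 2 * k y x + k x x))
      \<longlongrightarrow> rkhs_norm ip h * sqrt (k x x - 2 * k x x + k x x)) (at x)"
    by (intro tendsto_intros lims)
  then have bound: "((\<lambda>y. rkhs_norm ip h * sqrt (k y y - 2 * k y x + k x x)) \<longlongrightarrow> 0) (at x)"
    by simp
  have "\<bar>h y - h x\<bar> \<le> rkhs_norm ip h * sqrt (k y y - 2 * k y x + k x x)" for y
    using Cauchy_Schwarz[OF h diff_mem[OF section_mem[of y] section_mem[of x]]]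
    by (simp add: ip_diff_right section_mem h reproducing rkhs_norm_def ip_diff_sections)
  then have "((\<lambda>y. h y - h x) \<longlongrightarrow> 0) (at x)"
    by (intro Lim_null_comparison[OF _ bound]) simp
  then show "(h \<longlongrightarrow> h x) (at x within UNIV)"
    by (rule LIM_zero_cancel)
qed

lemma borel_measurable_mem: "h \<in> H \<Longrightarrow> h \<in> borel_measurable borel"
  by (rule borel_measurable_continuous_onI) (rule continuous_mem)

lemma abs_le_norm_sqrt_bound:
  assumes h: "h \<in> H" and B: "\<And>x y. \<bar>k x y\<bar> \<le> B"
  shows "\<bar>h x\<bar> \<le> rkhs_norm ip h * sqrt B"
proof -
  have "sqrt (k x x) \<le> sqrt B"
    using B[of x x] by simp
  then have "rkhs_norm ip h * sqrt (k x x) \<le> rkhs_norm ip h * sqrt B"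
    by (intro mult_left_mono norm_nonneg[OF h])
  then show ?thesis
    using abs_eval_le[OF h, of x] by linarith
qed

text \<open>
  \<open>Kw\<close> is the Riesz representative of the functional \<open>h \<mapsto> \<integral>x. h x * w x \<partial>P\<close>, which is bounded
  because evaluations are uniformly bounded: evaluating the representative at \<open>x\<close> means pairing it
  with the section at \<open>x\<close>. Hence \<open>Kw\<close> belongs to the space.
\<close>

lemma mean_embedding:
  assumes w: "sq_integrable P w"
  shows integrable_mem_mult: "\<And>h. h \<in> H \<Longrightarrow> integrable P (\<lambda>x. h x * w x)"
    and kernel_op_mem: "kernel_op k P w \<in> H"
    and ip_kernel_op: "\<And>h. h \<in> H \<Longrightarrow> ip h (kernel_op k P w) = (\<integral>x. h x * w x \<partial>P)"
proof -
  interpret P: prob_space P by (rule prob_space_P)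
  obtain B where B: "\<And>x y. \<bar>k x y\<bar> \<le> B"
    using bounded by blast
  have wint: "integrable P w"
    using w by (auto simp: sq_integrable_def intro: P.square_integrable_imp_integrable[of w])
  show int: "integrable P (\<lambda>x. h x * w x)" if h: "h \<in> H" for h
    using borel_measurable_mem[OF h] wint
    by (intro integrable_bounded_mult[OF _ abs_le_norm_sqrt_bound[OF h B]]) (simp_all add: measurable_P)
  define L where "L h = (\<integral>x. h x * w x \<partial>P)" for h
  have "\<exists>l\<in>H. \<forall>h\<in>H. ip h l = L h"
  proof (rule Riesz_representation)
    show "L (\<lambda>t. f t + g t) = L f + L g" if "f \<in> H" "g \<in> H" for f g
      using int that by (simp add: L_def distrib_right)
    show "L (\<lambda>t. a * f t) = a * L f" if "f \<in> H" for a f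
      by (simp add: L_def mult.assoc)
    show "\<bar>L f\<bar> \<le> (sqrt B * (\<integral>x. \<bar>w x\<bar> \<partial>P)) * rkhs_norm ip f" if f: "f \<in> H" for f
    proof -
      have "\<bar>L f\<bar> \<le> (\<integral>x. \<bar>f x * w x\<bar> \<partial>P)"
        unfolding L_def by (rule integral_abs_bound)
      also have "\<dots> \<le> (\<integral>x. rkhs_norm ip f * sqrt B * \<bar>w x\<bar> \<partial>P)"
      proof (rule integral_mono)
        show "\<bar>f x * w x\<bar> \<le> rkhs_norm ip f * sqrt B * \<bar>w x\<bar>" for x
          using abs_le_norm_sqrt_bound[OF f B, of x] by (simp add: abs_mult mult_right_mono)
      qed (use int[OF f] wint in auto)
      finally show ?thesis by (simp add: mult_ac)
    qed
  qed
  then obtain l where l: "l \<in> H" and repr: "\<And>h. h \<in> H \<Longrightarrow> ip h l = L h"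
    by blast
  have "kernel_op k P w x = l x" for x
  proof -
    have "kernel_op k P w x = L (\<lambda>t. k t x)"
      by (simp add: kernel_op_def L_def kernel_symmetric[of x])
    also have "\<dots> = ip (\<lambda>t. k t x) l"
      by (simp add: repr section_mem)
    also have "\<dots> = l x"
      using reproducing[OF l] ip_commute[OF section_mem l] by simp
    finally show ?thesis .
  qed
  then have eq: "kernel_op k P w = l"
    by (rule ext)
  show "kernel_op k P w \<in> H"
    by (simp add: eq l)
  show "ip h (kernel_op k P w) = (\<integral>x. h x * w x \<partial>P)" if "h \<in> H" for h
    by (simp add: eq repr that L_def)
qed

lemma output_integrable: "integrable \<rho> snd"
  by (rule law.square_integrable_imp_integrable[OF snd_law output_sq_integrable])

text \<open>
  The defining property of \<open>f0\<close> as a conditional expectation, tested with a bounded function of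
  the input.
\<close>

lemma integral_mult_output:
  assumes h: "h \<in> borel_measurable borel" and bnd: "\<And>x. \<bar>h x\<bar> \<le> c"
  shows "(\<integral>z. h (fst z) * snd z \<partial>\<rho>) = (\<integral>x. h x * f0 x \<partial>P)"
proof -
  let ?F = "vimage_algebra (space \<rho>) fst borel"
  have sub: "subalgebra \<rho> ?F"
    unfolding subalgebra_def
    using measurable_sets[OF fst_law] by (auto simp: sets_vimage_algebra intro!: sets.sigma_sets_subset)
  interpret F: finite_measure_subalgebra \<rho> ?F
    by standard (rule sub)
  have f0: "f0 \<in> borel_measurable borel"
    and ce: "AE z in \<rho>. real_cond_exp \<rho> ?F snd z = f0 (fst z)"
    using regression by (auto simp: regression_function_def)
  have fstF: "fst \<in> measurable ?F borel"
    by (rule measurable_vimage_algebra1) auto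
  have hF: "(\<lambda>z. h (fst z)) \<in> borel_measurable ?F"
    by (rule measurable_compose[OF fstF h])
  have h': "(\<lambda>z. h (fst z)) \<in> borel_measurable \<rho>"
    by (rule measurable_compose[OF fst_law h])
  have f0': "(\<lambda>z. f0 (fst z)) \<in> borel_measurable \<rho>"
    by (rule measurable_compose[OF fst_law f0])
  have int: "integrable \<rho> (\<lambda>z. h (fst z) * snd z)"
    by (rule integrable_bounded_mult[OF h' bnd output_integrable])
  have "(\<integral>z. h (fst z) * snd z \<partial>\<rho>) = (\<integral>z. h (fst z) * real_cond_exp \<rho> ?F snd z \<partial>\<rho>)"
    using F.real_cond_exp_intg(2)[OF int hF snd_law] by simp
  also have "\<dots> = (\<integral>z. h (fst z) * f0 (fst z) \<partial>\<rho>)"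
    using ce h' f0' by (intro integral_cong_AE) (auto intro!: borel_measurable_times borel_measurable_cond_exp2)
  also have "\<dots> = (\<integral>x. h x * f0 x \<partial>P)"
    using h f0 by (intro integral_P[symmetric]) auto
  finally show ?thesis .
qed

section \<open>Centring and variance of the fluctuations\<close>

context
  fixes lam :: real and w :: "'x \<Rightarrow> real"
  assumes w: "sq_integrable P w"
    and w_eq: "AE x in P. lam * w x + kernel_op k P w x = f0 x"
begin

abbreviation "g \<equiv> kernel_op k P w"

lemmas g_mem = kernel_op_mem[OF w]

text \<open>
  The fluctuation is a random element of the space whose empirical mean drives the error of the
  estimator. Its expectation is \<open>K (f0 - g) - lam * g\<close>, which is zero because \<open>f0 - g = lam * w\<close> and \<open>g = Kw\<close>.
\<close>

definition residual :: "'x \<times> real \<Rightarrow> real" where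
  "residual z = snd z - g (fst z)"

definition fluctuation :: "'x \<times> real \<Rightarrow> 'x \<Rightarrow> real" where
  "fluctuation z = (\<lambda>t. residual z * k t (fst z) - lam * g t)"

lemma fluctuation_mem: "fluctuation z \<in> H"
  unfolding fluctuation_def by (intro diff_mem scale_mem section_mem g_mem)

lemma mem_law: "h \<in> H \<Longrightarrow> (\<lambda>z. h (fst z)) \<in> borel_measurable \<rho>"
  by (rule measurable_compose[OF fst_law borel_measurable_mem])

lemma mem_mult_integrable:
  assumes "h \<in> H" "integrable \<rho> u"
  shows "integrable \<rho> (\<lambda>z. h (fst z) * u z)"
proof -
  obtain B where "\<And>x y. \<bar>k x y\<bar> \<le> B"
    using bounded by blast
  then show ?thesis
    using integrable_bounded_mult[OF mem_law[OF assms(1)] abs_le_norm_sqrt_bound[OF assms(1)] assms(2)]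
    by blast
qed

lemma mem_integrable: "h \<in> H \<Longrightarrow> integrable \<rho> (\<lambda>z. h (fst z))"
  using mem_mult_integrable[of h "\<lambda>_. 1"] by simp

lemma residual_integrable: "integrable \<rho> residual"
  unfolding residual_def[abs_def]
  by (intro Bochner_Integration.integrable_diff output_integrable mem_integrable g_mem)

text \<open>
  The weak form of \<open>E (residual * k(\<cdot>, X)) = lam * g\<close>, from which all integrals of
  fluctuations follow.
\<close>

lemma integral_mem_residual:
  assumes h: "h \<in> H"
  shows "(\<integral>z. h (fst z) * residual z \<partial>\<rho>) = lam * ip h g"
proof -
  obtain B where B: "\<And>x y. \<bar>k x y\<bar> \<le> B"
    using bounded by blast
  have hg: "integrable \<rho> (\<lambda>z. h (fst z) * g (fst z))"
    by (intro mem_mult_integrable mem_integrable h g_mem)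
  have m: "(\<lambda>x. h x * g x) \<in> borel_measurable borel"
    using borel_measurable_mem h g_mem by simp
  have hw: "integrable P (\<lambda>x. h x * w x)"
    by (rule integrable_mem_mult[OF w h])
  have "(\<integral>z. h (fst z) * residual z \<partial>\<rho>) = (\<integral>z. h (fst z) * snd z - h (fst z) * g (fst z) \<partial>\<rho>)"
    by (simp add: residual_def right_diff_distrib)
  also have "\<dots> = (\<integral>z. h (fst z) * snd z \<partial>\<rho>) - (\<integral>z. h (fst z) * g (fst z) \<partial>\<rho>)"
    by (intro Bochner_Integration.integral_diff mem_mult_integrable[OF h output_integrable] hg)
  also have "(\<integral>z. h (fst z) * snd z \<partial>\<rho>) = (\<integral>x. h x * f0 x \<partial>P)"
    by (rule integral_mult_output[OF borel_measurable_mem[OF h] abs_le_norm_sqrt_bound[OF h B]])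
  also have "\<dots> = (\<integral>x. lam * (h x * w x) + h x * g x \<partial>P)"
  proof (rule integral_cong_AE)
    show "(\<lambda>x. h x * f0 x) \<in> borel_measurable P"
      using regression borel_measurable_mem[OF h] by (auto simp: regression_function_def measurable_P)
    show "(\<lambda>x. lam * (h x * w x) + h x * g x) \<in> borel_measurable P"
      using w borel_measurable_mem[OF h] borel_measurable_mem[OF g_mem] by (auto simp: sq_integrable_def measurable_P)
    show "AE x in P. h x * f0 x = lam * (h x * w x) + h x * g x"
      using w_eq
    proof eventually_elim
      case (elim x)
      show ?case
        unfolding elim[symmetric] by (simp add: algebra_simps)
    qed
  qed
  also have "\<dots> = lam * (\<integral>x. h x * w x \<partial>P) + (\<integral>x. h x * g x \<partial>P)"
    using hw hg integrable_P[OF m] by simp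
  also have "(\<integral>x. h x * g x \<partial>P) = (\<integral>z. h (fst z) * g (fst z) \<partial>\<rho>)"
    by (rule integral_P[OF m])
  also have "(\<integral>x. h x * w x \<partial>P) = ip h g"
    by (rule ip_kernel_op[OF w h, symmetric])
  finally show ?thesis by simp
qed

text \<open>
  The bound is uniform in \<open>lam\<close>: since \<open>snd z = residual z + g (fst z)\<close>, the difference of the two
  sides is \<open>2 * E (g * residual) + E g\<^sup>2\<close>, and the mixed term \<open>E (g * residual) = lam * \<langle>g | g\<rangle>\<close> is
  nonnegative. This expresses the positivity of the kernel operator.
\<close>

lemma residual_sq:
  assumes lam: "lam \<ge> 0"
  shows residual_sq_integrable: "integrable \<rho> (\<lambda>z. (residual z)\<^sup>2)"
    and integral_residual_sq_le: "(\<integral>z. (residual z)\<^sup>2 \<partial>\<rho>) \<le> (\<integral>z. (snd z)\<^sup>2 \<partial>\<rho>)"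
proof -
  have gr: "integrable \<rho> (\<lambda>z. g (fst z) * residual z)"
    by (rule mem_mult_integrable[OF g_mem residual_integrable])
  have gg: "integrable \<rho> (\<lambda>z. g (fst z) * g (fst z))"
    by (intro mem_mult_integrable mem_integrable g_mem)
  have eq: "(residual z)\<^sup>2 = (snd z)\<^sup>2 - 2 * (g (fst z) * residual z) - g (fst z) * g (fst z)" for z
    by (simp add: residual_def power2_eq_square algebra_simps)
  show "integrable \<rho> (\<lambda>z. (residual z)\<^sup>2)"
    unfolding eq using gr gg output_sq_integrable by simp
  have "(\<integral>z. (residual z)\<^sup>2 \<partial>\<rho>)
      = (\<integral>z. (snd z)\<^sup>2 \<partial>\<rho>) - 2 * (lam * ip g g) - (\<integral>z. g (fst z) * g (fst z) \<partial>\<rho>)"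
    unfolding eq using gr gg output_sq_integrable by (simp add: integral_mem_residual[OF g_mem])
  moreover have "0 \<le> (\<integral>z. g (fst z) * g (fst z) \<partial>\<rho>)"
    by (rule integral_nonneg_AE) simp
  moreover have "0 \<le> lam * ip g g"
    using lam ip_nonneg[OF g_mem] by simp
  ultimately show "(\<integral>z. (residual z)\<^sup>2 \<partial>\<rho>) \<le> (\<integral>z. (snd z)\<^sup>2 \<partial>\<rho>)"
    by linarith
qed

lemma ip_fluctuation:
  "ip (fluctuation z) (fluctuation z') =
     residual z * (residual z' * k (fst z) (fst z')) - lam * (residual z * g (fst z))
     - lam * (residual z' * g (fst z')) + lam\<^sup>2 * ip g g"
proof -
  have gk: "ip g (\<lambda>t. k t x) = g x" "ip (\<lambda>t. k t x) g = g x" for x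
    using reproducing[OF g_mem] ip_commute[OF section_mem g_mem] by auto
  show ?thesis
    unfolding fluctuation_def
    by (simp add: ip_diff_left ip_diff_right diff_mem scale_mem section_mem g_mem
        ip_scale_left ip_scale_right reproducing[OF section_mem] gk power2_eq_square
        kernel_symmetric[of "fst z'"] right_diff_distrib)
qed

lemma fluctuation_degenerate: "(\<integral>z'. ip (fluctuation z) (fluctuation z') \<partial>\<rho>) = 0"
proof -
  have kr: "integrable \<rho> (\<lambda>z'. k (fst z') (fst z) * residual z')"
    by (rule mem_mult_integrable[OF section_mem residual_integrable])
  have gr: "integrable \<rho> (\<lambda>z. g (fst z) * residual z)"
    by (rule mem_mult_integrable[OF g_mem residual_integrable])
  have gk: "ip (\<lambda>t. k t x) g = g x" for x
    using reproducing[OF g_mem] ip_commute[OF section_mem g_mem] by auto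
  have "(\<integral>z'. ip (fluctuation z) (fluctuation z') \<partial>\<rho>) =
      (\<integral>z'. residual z * (k (fst z') (fst z) * residual z') - lam * (residual z * g (fst z))
        - lam * (g (fst z') * residual z') + lam\<^sup>2 * ip g g \<partial>\<rho>)"
    by (simp add: ip_fluctuation kernel_symmetric[of "fst z"] mult_ac)
  also have "\<dots> = residual z * (lam * g (fst z)) - lam * (residual z * g (fst z))
      - lam * (lam * ip g g) + lam\<^sup>2 * ip g g"
    using kr gr
    by (simp add: integral_mem_residual[OF section_mem] integral_mem_residual[OF g_mem] gk law.prob_space)
  finally show ?thesis
    by (simp add: power2_eq_square)
qed

text \<open>
  Expanding the square, the mixed term and the constant term add up to \<open>- lam\<^sup>2 * \<langle>g | g\<rangle>\<close>; what
  remains is the second moment of the residual, weighted by the kernel on the diagonal.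
\<close>

lemma fluctuation_diag:
  assumes lam: "lam \<ge> 0" and B: "\<And>x y. \<bar>k x y\<bar> \<le> B"
  shows fluctuation_diag_integrable: "integrable \<rho> (\<lambda>z. ip (fluctuation z) (fluctuation z))"
    and integral_fluctuation_diag_le:
      "(\<integral>z. ip (fluctuation z) (fluctuation z) \<partial>\<rho>) \<le> B * (\<integral>z. (snd z)\<^sup>2 \<partial>\<rho>)"
proof -
  have B0: "0 \<le> B"
    using B order_trans[OF abs_ge_zero] by blast
  have diag: "(\<lambda>x. k x x) \<in> borel_measurable borel"
    using measurable_compose[OF measurable_Pair[OF measurable_ident measurable_ident] measurable]
    by (simp add: id_def)
  have kr: "integrable \<rho> (\<lambda>z. k (fst z) (fst z) * (residual z)\<^sup>2)"
    using integrable_bounded_mult[OF measurable_compose[OF fst_law diag] _ residual_sq_integrable[OF lam]] B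
    by blast
  have gr: "integrable \<rho> (\<lambda>z. g (fst z) * residual z)"
    by (rule mem_mult_integrable[OF g_mem residual_integrable])
  have eq: "ip (fluctuation z) (fluctuation z) =
      k (fst z) (fst z) * (residual z)\<^sup>2 - 2 * lam * (g (fst z) * residual z) + lam\<^sup>2 * ip g g" for z
    by (simp add: ip_fluctuation power2_eq_square algebra_simps)
  show "integrable \<rho> (\<lambda>z. ip (fluctuation z) (fluctuation z))"
    unfolding eq using kr gr by simp
  have "(\<integral>z. ip (fluctuation z) (fluctuation z) \<partial>\<rho>) =
      (\<integral>z. k (fst z) (fst z) * (residual z)\<^sup>2 \<partial>\<rho>) - 2 * lam * (lam * ip g g) + lam\<^sup>2 * ip g g"
    unfolding eq using kr gr by (simp add: integral_mem_residual[OF g_mem] law.prob_space)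
  also have "\<dots> = (\<integral>z. k (fst z) (fst z) * (residual z)\<^sup>2 \<partial>\<rho>) - lam\<^sup>2 * ip g g"
    by (simp add: power2_eq_square)
  also have "\<dots> \<le> (\<integral>z. k (fst z) (fst z) * (residual z)\<^sup>2 \<partial>\<rho>)"
    using ip_nonneg[OF g_mem] by simp
  also have "\<dots> \<le> (\<integral>z. B * (residual z)\<^sup>2 \<partial>\<rho>)"
    using kr residual_sq_integrable[OF lam] abs_le_D1[OF B]
    by (intro integral_mono) (simp_all add: mult_right_mono)
  also have "\<dots> = B * (\<integral>z. (residual z)\<^sup>2 \<partial>\<rho>)"
    by simp
  also have "\<dots> \<le> B * (\<integral>z. (snd z)\<^sup>2 \<partial>\<rho>)"
    by (intro mult_left_mono integral_residual_sq_le[OF lam] B0)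
  finally show "(\<integral>z. ip (fluctuation z) (fluctuation z) \<partial>\<rho>) \<le> B * (\<integral>z. (snd z)\<^sup>2 \<partial>\<rho>)" .
qed

lemma fluctuation_measurable:
  "(\<lambda>p. ip (fluctuation (fst p)) (fluctuation (snd p))) \<in> borel_measurable (\<rho> \<Otimes>\<^sub>M \<rho>)"
proof -
  have [measurable]: "residual \<in> borel_measurable \<rho>"
    by (rule borel_measurable_integrable[OF residual_integrable])
  have [measurable]: "(\<lambda>z. g (fst z)) \<in> borel_measurable \<rho>"
    by (rule mem_law[OF g_mem])
  have "(\<lambda>p. (fst (fst p), fst (snd p))) \<in> measurable (\<rho> \<Otimes>\<^sub>M \<rho>) (borel \<Otimes>\<^sub>M borel)"
    by measurable
  from measurable_compose[OF this measurable]
  have [measurable]: "(\<lambda>p. k (fst (fst p)) (fst (snd p))) \<in> borel_measurable (\<rho> \<Otimes>\<^sub>M \<rho>)"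
    by simp
  show ?thesis
    unfolding ip_fluctuation by measurable
qed

lemma abs_ip_fluctuation_le:
  "\<bar>ip (fluctuation z) (fluctuation z')\<bar>
     \<le> ip (fluctuation z) (fluctuation z) + ip (fluctuation z') (fluctuation z')"
proof -
  have "\<bar>ip (fluctuation z) (fluctuation z')\<bar> \<le> rkhs_norm ip (fluctuation z) * rkhs_norm ip (fluctuation z')"
    by (rule Cauchy_Schwarz[OF fluctuation_mem fluctuation_mem])
  also have "\<dots> \<le> (rkhs_norm ip (fluctuation z))\<^sup>2 + (rkhs_norm ip (fluctuation z'))\<^sup>2"
    using sum_squares_bound[of "rkhs_norm ip (fluctuation z)" "rkhs_norm ip (fluctuation z')"]
      mult_nonneg_nonneg[OF norm_nonneg[OF fluctuation_mem, of z] norm_nonneg[OF fluctuation_mem, of z']]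
    unfolding mult.assoc by linarith
  finally show ?thesis
    by (simp add: norm_sq fluctuation_mem)
qed

end

section \<open>The expected squared error\<close>

text \<open>
  The weights are given pointwise as solutions of the linear system; as limits of Richardson
  iterates they are random variables.
\<close>

lemma weights_measurable:
  assumes x: "\<And>i. i \<in> {1..n} \<Longrightarrow> X i \<in> measurable M borel"
    and y: "\<And>i. i \<in> {1..n} \<Longrightarrow> F i \<in> borel_measurable M"
    and sol: "\<And>\<omega>. \<omega> \<in> space M \<Longrightarrow> solves_weights k lam n (\<lambda>i. X i \<omega>) (\<lambda>i. F i \<omega>) (\<lambda>i. W i \<omega>)"
    and lam: "lam > 0" and i: "i \<in> {1..n}"
  shows "W i \<in> borel_measurable M"
proof -
  obtain B where B: "\<And>x y. \<bar>k x y\<bar> \<le> B"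
    using bounded by blast
  define \<tau> where "\<tau> = lam / (2 * lam\<^sup>2 + 2 * (real (card {1..n}) * (B / real n))\<^sup>2)"
  define A where "A \<omega> i j = k (X i \<omega>) (X j \<omega>) / real n" for \<omega> i j
  define c where "c m i \<omega> = richardson \<tau> lam {1..n} (A \<omega>) (\<lambda>i. F i \<omega>) m i" for m i \<omega>
  have [measurable]: "(\<lambda>\<omega>. A \<omega> i j) \<in> borel_measurable M" if "i \<in> {1..n}" "j \<in> {1..n}" for i j
    using measurable_compose[OF measurable_Pair[OF x[OF that(1)] x[OF that(2)]] measurable]
    by (simp add: A_def)
  have cm: "c m i \<in> borel_measurable M" if "i \<in> {1..n}" for m i
    using that
  proof (induction m arbitrary: i)
    case 0
    then show ?case by (simp add: c_def[abs_def])
  next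
    case (Suc m)
    have "c (Suc m) i = (\<lambda>\<omega>. c m i \<omega> - \<tau> * (lam * c m i \<omega> + (\<Sum>j=1..n. A \<omega> i j * c m j \<omega>) - F i \<omega>))"
      by (simp add: c_def fun_eq_iff)
    moreover have "(\<lambda>\<omega>. \<Sum>j=1..n. A \<omega> i j * c m j \<omega>) \<in> borel_measurable M"
      using Suc by (intro borel_measurable_sum borel_measurable_times) auto
    ultimately show ?case
      using Suc y by simp
  qed
  show ?thesis
  proof (rule borel_measurable_LIMSEQ_real)
    show "c m i \<in> borel_measurable M" for m
      by (rule cm[OF i])
    fix \<omega> assume \<omega>: "\<omega> \<in> space M"
    show "(\<lambda>m. c m i \<omega>) \<longlonglongrightarrow> W i \<omega>"
      unfolding c_def
    proof (rule richardson_tendsto[OF _ lam _ _ _ \<tau>_def i])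
      show "0 \<le> (\<Sum>i=1..n. e i * (\<Sum>j=1..n. A \<omega> i j * e j))" for e
      proof -
        have "(\<Sum>i=1..n. e i * (\<Sum>j=1..n. A \<omega> i j * e j)) =
            (\<Sum>i=1..n. e i * (\<Sum>j=1..n. k (X i \<omega>) (X j \<omega>) * e j)) / real n"
          by (simp add: A_def sum_divide_distrib sum_distrib_left)
        then show ?thesis
          using gram_nonneg[where I = "{1..n}" and e = e and x = "\<lambda>i. X i \<omega>"] by simp
      qed
      show "\<bar>A \<omega> i j\<bar> \<le> B / real n" for i j
        using B by (simp add: A_def divide_right_mono)
      show "lam * W i \<omega> + (\<Sum>j=1..n. A \<omega> i j * W j \<omega>) = F i \<omega>" if "i \<in> {1..n}" for i
        using sol[OF \<omega>] that by (simp add: solves_weights_def A_def sum_divide_distrib)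
    qed simp
  qed
qed

text \<open>
  \<open>lam\<^sup>2 * err\<close> is at most the squared norm of the mean of \<open>n\<close> independent centred fluctuations,
  whose expectation is their variance divided by \<open>n\<close>.
\<close>

lemma expected_error_bound:
  fixes M :: "'w measure"
  assumes B: "\<And>x y. \<bar>k x y\<bar> \<le> B" and lam: "lam > 0" and n: "n \<ge> 1"
    and w: "sq_integrable P w" and w_eq: "AE x in P. lam * w x + kernel_op k P w x = f0 x"
    and iid: "iid_sample M \<rho> n X F"
    and sol: "\<And>\<omega>. \<omega> \<in> space M \<Longrightarrow> solves_weights k lam n (\<lambda>i. X i \<omega>) (\<lambda>i. F i \<omega>) (\<lambda>i. W i \<omega>)"
  defines "err \<equiv> (\<lambda>\<omega>. (rkhs_norm ip (\<lambda>t. estimator k n (\<lambda>i. X i \<omega>) (\<lambda>i. W i \<omega>) t - kernel_op k P w t))\<^sup>2)"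
  shows "integrable M err" and "(\<integral>\<omega>. err \<omega> \<partial>M) \<le> B * (\<integral>z. (snd z)\<^sup>2 \<partial>\<rho>) / (lam\<^sup>2 * real n)"
proof -
  interpret M: prob_space M
    using iid by (simp add: iid_sample_def)
  let ?g = "kernel_op k P w"
  let ?fl = "fluctuation lam w"
  let ?Z = "\<lambda>i \<omega>. (X i \<omega>, F i \<omega>)"
  let ?f = "\<lambda>\<omega>. estimator k n (\<lambda>i. X i \<omega>) (\<lambda>i. W i \<omega>)"
  let ?S = "\<lambda>\<omega>. \<Sum>i=1..n. \<Sum>j=1..n. ip (?fl (?Z i \<omega>)) (?fl (?Z j \<omega>))"
  have indep: "M.indep_vars (\<lambda>_. borel \<Otimes>\<^sub>M borel) ?Z {1..n}"
    and law: "\<And>i. i \<in> {1..n} \<Longrightarrow> distr M (borel \<Otimes>\<^sub>M borel) (?Z i) = \<rho>"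
    using iid by (auto simp: iid_sample_def)
  have Zm: "?Z i \<in> measurable M (borel \<Otimes>\<^sub>M borel)" if "i \<in> {1..n}" for i
    using indep that by (auto simp: M.indep_vars_def)
  have Xm: "X i \<in> measurable M borel" and Fm: "F i \<in> borel_measurable M" if "i \<in> {1..n}" for i
    using measurable_compose[OF Zm[OF that] measurable_fst] measurable_compose[OF Zm[OF that] measurable_snd]
    by simp_all
  have Wm: "W i \<in> borel_measurable M" if "i \<in> {1..n}" for i
    by (rule weights_measurable[OF Xm Fm sol lam that])
  have g: "?g \<in> H"
    by (rule kernel_op_mem[OF w])
  have S_int: "integrable M ?S"
    and S_eq: "(\<integral>\<omega>. ?S \<omega> \<partial>M) = real n * (\<integral>z. ip (?fl z) (?fl z) \<partial>\<rho>)"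
    using M.expectation_degenerate_double_sum[OF indep law _ fluctuation_measurable[OF w w_eq]
        fluctuation_diag_integrable[OF w w_eq _ B] abs_ip_fluctuation_le[OF w w_eq]
        fluctuation_degenerate[OF w w_eq]] lam
    by simp_all
  have err_ip: "err \<omega> = ip (\<lambda>t. ?f \<omega> t - ?g t) (\<lambda>t. ?f \<omega> t - ?g t)" for \<omega>
    unfolding err_def by (rule norm_sq) (intro diff_mem estimator_mem g)
  have err_nonneg: "0 \<le> err \<omega>" for \<omega>
    by (simp add: err_def)
  have err_le: "err \<omega> \<le> 1 / (lam\<^sup>2 * (real n)\<^sup>2) * ?S \<omega>" if "\<omega> \<in> space M" for \<omega>
  proof -
    have "lam\<^sup>2 * err \<omega> \<le> 1 / (real n)\<^sup>2 * ?S \<omega>"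
      using estimator_deviation[OF sol[OF that] g lam n]
      by (simp add: err_ip fluctuation_def[OF w w_eq] residual_def[OF w w_eq])
    then have "err \<omega> * lam\<^sup>2 \<le> 1 / (real n)\<^sup>2 * ?S \<omega>"
      by (subst mult.commute)
    then have "err \<omega> \<le> 1 / (real n)\<^sup>2 * ?S \<omega> / lam\<^sup>2"
      using lam by (intro iffD2[OF pos_le_divide_eq]) simp
    then show ?thesis
      by (simp add: mult.commute)
  qed
  \<comment> \<open>The square is expanded into a finite expression in the weights, the kernel and \<open>g\<close>.\<close>
  have err_meas: "err \<in> borel_measurable M"
  proof -
    have err_eq: "err \<omega> = 1 / real n * (\<Sum>i=1..n. W i \<omega> * (1 / real n * (\<Sum>j=1..n. k (X i \<omega>) (X j \<omega>) * W j \<omega>)))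
        - 2 * (1 / real n * (\<Sum>i=1..n. W i \<omega> * ?g (X i \<omega>))) + ip ?g ?g" for \<omega>
    proof -
      have "err \<omega> = ip (?f \<omega>) (?f \<omega>) - 2 * ip ?g (?f \<omega>) + ip ?g ?g"
        using ip_commute[OF estimator_mem g]
        by (simp add: err_ip ip_diff_left ip_diff_right diff_mem estimator_mem g)
      also have "ip (?f \<omega>) (?f \<omega>) = 1 / real n * (\<Sum>i=1..n. W i \<omega> * ?f \<omega> (X i \<omega>))"
        by (rule ip_estimator[OF estimator_mem])
      also have "ip ?g (?f \<omega>) = 1 / real n * (\<Sum>i=1..n. W i \<omega> * ?g (X i \<omega>))"
        by (rule ip_estimator[OF g])
      finally show ?thesis
        by (simp add: estimator_def)
    qed
    have "(\<lambda>\<omega>. k (X i \<omega>) (X j \<omega>)) \<in> borel_measurable M" if "i \<in> {1..n}" "j \<in> {1..n}" for i j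
      using measurable_compose[OF measurable_Pair[OF Xm[OF that(1)] Xm[OF that(2)]] measurable] by simp
    moreover have "(\<lambda>\<omega>. ?g (X i \<omega>)) \<in> borel_measurable M" if "i \<in> {1..n}" for i
      by (rule measurable_compose[OF Xm[OF that] borel_measurable_mem[OF g]])
    ultimately show ?thesis
      unfolding err_eq[abs_def] using Wm
      by (intro borel_measurable_add borel_measurable_diff borel_measurable_times borel_measurable_sum
          borel_measurable_const)
  qed
  show int: "integrable M err"
  proof (rule Bochner_Integration.integrable_bound)
    show "integrable M (\<lambda>\<omega>. 1 / (lam\<^sup>2 * (real n)\<^sup>2) * ?S \<omega>)"
      using S_int by (rule integrable_mult_right)
    show "AE \<omega> in M. norm (err \<omega>) \<le> norm (1 / (lam\<^sup>2 * (real n)\<^sup>2) * ?S \<omega>)"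
    proof (rule AE_I2)
      fix \<omega> assume "\<omega> \<in> space M"
      then show "norm (err \<omega>) \<le> norm (1 / (lam\<^sup>2 * (real n)\<^sup>2) * ?S \<omega>)"
        using order_trans[OF err_le abs_ge_self] err_nonneg[of \<omega>]
        unfolding real_norm_def by (simp only: abs_of_nonneg)
    qed
  qed (rule err_meas)
  have "(\<integral>\<omega>. err \<omega> \<partial>M) \<le> (\<integral>\<omega>. 1 / (lam\<^sup>2 * (real n)\<^sup>2) * ?S \<omega> \<partial>M)"
    by (rule integral_mono[OF int integrable_mult_right[OF S_int] err_le])
  also have "\<dots> = 1 / (lam\<^sup>2 * (real n)\<^sup>2) * (real n * (\<integral>z. ip (?fl z) (?fl z) \<partial>\<rho>))"
    unfolding S_eq[symmetric] by (rule integral_mult_right_zero)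
  also have "\<dots> = (\<integral>z. ip (?fl z) (?fl z) \<partial>\<rho>) / (lam\<^sup>2 * real n)"
    using n by (simp add: power2_eq_square)
  also have "\<dots> \<le> B * (\<integral>z. (snd z)\<^sup>2 \<partial>\<rho>) / (lam\<^sup>2 * real n)"
    using integral_fluctuation_diag_le[OF w w_eq _ B] lam by (intro divide_right_mono) auto
  finally show "(\<integral>\<omega>. err \<omega> \<partial>M) \<le> B * (\<integral>z. (snd z)\<^sup>2 \<partial>\<rho>) / (lam\<^sup>2 * real n)" .
qed

end

theorem theorem6p1:
  fixes k :: "'x::topological_space \<Rightarrow> 'x \<Rightarrow> real"
    and H :: "('x \<Rightarrow> real) set"
    and ip :: "('x \<Rightarrow> real) \<Rightarrow> ('x \<Rightarrow> real) \<Rightarrow> real"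
    and \<rho> :: "('x \<times> real) measure"
    and f0 :: "'x \<Rightarrow> real"
  assumes "bounded_kernel k"
    and "rkhs k H ip"
    and "prob_space \<rho>"
    and "sets \<rho> = sets (borel \<Otimes>\<^sub>M borel)"
    and "integrable \<rho> (\<lambda>z. (snd z)\<^sup>2)"
    and "regression_function \<rho> f0"
  shows "\<exists>C1>0. \<exists>C2>0. \<forall>lam>0. \<forall>n\<ge>1.
    \<forall>w. sq_integrable (input_law \<rho>) w \<and>
        (AE x in input_law \<rho>. lam * w x + kernel_op k (input_law \<rho>) w x = f0 x) \<longrightarrow>
    (\<forall>(M :: 'w measure) X F W.
        iid_sample M \<rho> n X F \<and>
        (\<forall>\<omega>\<in>space M. solves_weights k lam n (\<lambda>i. X i \<omega>) (\<lambda>i. F i \<omega>) (\<lambda>i. W i \<omega>)) \<longrightarrow>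
        (let err = (\<lambda>\<omega>. (rkhs_norm ip (\<lambda>t.
               estimator k n (\<lambda>i. X i \<omega>) (\<lambda>i. W i \<omega>) t - kernel_op k (input_law \<rho>) w t))\<^sup>2)
         in integrable M err \<and>
            (\<integral>\<omega>. err \<omega> \<partial>M) \<le> 2 * C1 / (lam\<^sup>2 * real n) + C2 / (lam ^ 3 * real n)))"
proof -
  interpret bounded_kernel k by fact
  interpret rkhs k H ip by fact
  interpret law: prob_space \<rho> by fact
  interpret kernel_regression k H ip \<rho> f0
    by unfold_locales fact+
  obtain B where B: "\<And>x y. \<bar>k x y\<bar> \<le> B"
    using bounded by blast
  \<comment> \<open>The error is at most \<open>E / (lam\<^sup>2 * n)\<close> for this \<open>E\<close>; adding 1 makes the constants positive
    even if \<open>E = 0\<close>.\<close>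
  define E where "E = B * (\<integral>z. (snd z)\<^sup>2 \<partial>\<rho>)"
  have "0 \<le> B"
    using B order_trans[OF abs_ge_zero] by blast
  then have E: "0 \<le> E"
    by (simp add: E_def)
  have "E / (lam\<^sup>2 * real n) \<le> 2 * (E + 1) / (lam\<^sup>2 * real n) + (E + 1) / (lam ^ 3 * real n)"
    if "lam > 0" for lam :: real and n :: nat
  proof -
    have "E / (lam\<^sup>2 * real n) \<le> 2 * (E + 1) / (lam\<^sup>2 * real n)"
      using E by (intro divide_right_mono) auto
    moreover have "0 \<le> (E + 1) / (lam ^ 3 * real n)"
      using E that by simp
    ultimately show ?thesis by linarith
  qed
  note weaken = order_trans[OF _ this]
  show ?thesis
  proof (intro exI[of _ "E + 1"] conjI allI impI)
    fix lam :: real and n w and M :: "'w measure" and X F W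
    assume lam: "lam > 0" and n: "n \<ge> 1"
      and w: "sq_integrable P w \<and> (AE x in P. lam * w x + kernel_op k P w x = f0 x)"
      and sample: "iid_sample M \<rho> n X F \<and>
        (\<forall>\<omega>\<in>space M. solves_weights k lam n (\<lambda>i. X i \<omega>) (\<lambda>i. F i \<omega>) (\<lambda>i. W i \<omega>))"
    note error = expected_error_bound[OF B lam n conjunct1[OF w] conjunct2[OF w]
        conjunct1[OF sample] conjunct2[OF sample, rule_format], folded E_def]
    show "let err = (\<lambda>\<omega>. (rkhs_norm ip (\<lambda>t.
               estimator k n (\<lambda>i. X i \<omega>) (\<lambda>i. W i \<omega>) t - kernel_op k P w t))\<^sup>2)
         in integrable M err \<and>
            (\<integral>\<omega>. err \<omega> \<partial>M) \<le> 2 * (E + 1) / (lam\<^sup>2 * real n) + (E + 1) / (lam ^ 3 * real n)"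
      unfolding Let_def using error(1) weaken[OF error(2) lam] by (rule conjI)
  qed (use E in simp_all)
qed

end
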